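(* Let $(A,B)$ be controllable, $Q_t\in\mathcal Q$, $R_t\in\mathcal R$ ($0\le t\le N-1$), $Q_N\in\mathcal P$, let $P_t$ be defined by $P_N=Q_N$, $P_t=Q_t+A^\top\big(P_{t+1}-P_{t+1}B(R_t+B^\top P_{t+1}B)^{-1}B^\top P_{t+1}\big)A$, and let $K_t=(R_t+B^\top P_{t+1}B)^{-1}B^\top P_{t+1}A$ and $D_t=A-BK_t$ for $0\le t\le N-1$. Define $\Phi(t,t_0)=D_{t-1}\cdots D_{t_0}$ for $t>t_0$ and $\Phi(t,t)=I$. Then for all $0\le t_0\le t\le N$, $$\|\Phi(t,t_0)\|\le c_7c_2^{\,t-t_0},\qquad c_7=\sqrt{\upsilon_{\max}(\bar P)/\upsilon_{\min}(\underline P)},\quad c_2=\sqrt{1-\mu_f/\upsilon_{\max}(\bar P)}\in[0,1).$$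
   Context: Fix $\mu_f,\mu_g>0$, $0<l_f,l_g<\infty$. $P^e(Q,R)$ denotes the positive definite solution of the DARE $P=Q+A^\top(P-PB(B^\top PB+R)^{-1}B^\top P)A$. $\mathcal Q=\{Q:\mu_fI_n\le Q\le l_fI_n\}$, $\mathcal R=\{R:\mu_gI_m\le R\le l_gI_m\}$, $\bar P=P^e(l_fI_n,l_gI_m)$, $\underline P=P^e(\mu_fI_n,\mu_gI_m)$, $\mathcal P=\{P:\underline P\le P\le\bar P\}$ (Loewner order). $\upsilon_{\max},\upsilon_{\min}$ denote largest and smallest eigenvalues. *)

theory Defs
  imports "HOL-Analysis.Analysis"
begin

type_synonym ('n) sqmat = "real^'n^'n"

text \<open>Positive semidefinite / positive definite (symmetric) matrices and the Loewner order.\<close>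
definition psd :: "real^'n^'n \<Rightarrow> bool" where
  "psd M \<longleftrightarrow> transpose M = M \<and> (\<forall>x. 0 \<le> x \<bullet> (M *v x))"

definition pos_def :: "real^'n^'n \<Rightarrow> bool" where
  "pos_def M \<longleftrightarrow> transpose M = M \<and> (\<forall>x. x \<noteq> 0 \<longrightarrow> 0 < x \<bullet> (M *v x))"

definition loewner_le :: "real^'n^'n \<Rightarrow> real^'n^'n \<Rightarrow> bool" where
  "loewner_le X Y \<longleftrightarrow> psd (Y - X)"

text \<open>Eigenvalues; largest and smallest eigenvalue.\<close>
definition eigenvalues :: "real^'n^'n \<Rightarrow> real set" where
  "eigenvalues M = {l. \<exists>v. v \<noteq> 0 \<and> M *v v = l *\<^sub>R v}"

definition eig_max :: "real^'n^'n \<Rightarrow> real" where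
  "eig_max M = Max (eigenvalues M)"

definition eig_min :: "real^'n^'n \<Rightarrow> real" where
  "eig_min M = Min (eigenvalues M)"

text \<open>Controllability: rank [B, AB, ..., A^(n-1)B] = n, i.e. the columns span R^n.\<close>
definition controllable :: "real^'n^'n \<Rightarrow> real^'m^'n \<Rightarrow> bool" where
  "controllable A B \<longleftrightarrow>
     span (\<Union>k<CARD('n). range (\<lambda>u. (((*v) A) ^^ k) (B *v u))) = UNIV"

text \<open>Riccati map  Q + A^T (P - P B (B^T P B + R)^{-1} B^T P) A.\<close>
definition ric :: "real^'n^'n \<Rightarrow> real^'m^'n \<Rightarrow> real^'n^'n \<Rightarrow> real^'m^'m \<Rightarrow> real^'n^'n \<Rightarrow> real^'n^'n" where
  "ric A B Q R P = Q + transpose A ** (P - P ** B ** matrix_inv (transpose B ** P ** B + R) ** transpose B ** P) ** A"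

text \<open>P^e(Q,R): the positive definite solution of the DARE.\<close>
definition dare_sol :: "real^'n^'n \<Rightarrow> real^'m^'n \<Rightarrow> real^'n^'n \<Rightarrow> real^'m^'m \<Rightarrow> real^'n^'n" where
  "dare_sol A B Q R = (THE P. pos_def P \<and> P = ric A B Q R P)"

definition Qset :: "real \<Rightarrow> real \<Rightarrow> (real^'n^'n) set" where
  "Qset mu l = {Q. loewner_le (mu *\<^sub>R mat 1) Q \<and> loewner_le Q (l *\<^sub>R mat 1)}"

definition Pset :: "real^'n^'n \<Rightarrow> real^'m^'n \<Rightarrow> real \<Rightarrow> real \<Rightarrow> real \<Rightarrow> real \<Rightarrow> (real^'n^'n) set" where
  "Pset A B mu_f l_f mu_g l_g =
     {P. loewner_le (dare_sol A B (mu_f *\<^sub>R mat 1) (mu_g *\<^sub>R mat 1)) P \<and>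
         loewner_le P (dare_sol A B (l_f *\<^sub>R mat 1) (l_g *\<^sub>R mat 1))}"

text \<open>Backward Riccati recursion: riccati_aux k = P_{N-k}; P_N = Q_N,
  P_t = ric A B Q_t R_t P_{t+1}.\<close>
primrec riccati_aux :: "real^'n^'n \<Rightarrow> real^'m^'n \<Rightarrow> (nat \<Rightarrow> real^'n^'n) \<Rightarrow> (nat \<Rightarrow> real^'m^'m) \<Rightarrow> nat \<Rightarrow> nat \<Rightarrow> real^'n^'n" where
  "riccati_aux A B Q R N 0 = Q N"
| "riccati_aux A B Q R N (Suc k) = ric A B (Q (N - Suc k)) (R (N - Suc k)) (riccati_aux A B Q R N k)"

definition riccati :: "real^'n^'n \<Rightarrow> real^'m^'n \<Rightarrow> (nat \<Rightarrow> real^'n^'n) \<Rightarrow> (nat \<Rightarrow> real^'m^'m) \<Rightarrow> nat \<Rightarrow> nat \<Rightarrow> real^'n^'n" where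
  "riccati A B Q R N t = riccati_aux A B Q R N (N - t)"

text \<open>Gain K_t and closed-loop matrix D_t = A - B K_t.\<close>
definition gain :: "real^'n^'n \<Rightarrow> real^'m^'n \<Rightarrow> (nat \<Rightarrow> real^'n^'n) \<Rightarrow> (nat \<Rightarrow> real^'m^'m) \<Rightarrow> nat \<Rightarrow> nat \<Rightarrow> real^'n^'m" where
  "gain A B Q R N t = (let P = riccati A B Q R N (Suc t) in
      matrix_inv (R t + transpose B ** P ** B) ** transpose B ** P ** A)"

definition closed_loop :: "real^'n^'n \<Rightarrow> real^'m^'n \<Rightarrow> (nat \<Rightarrow> real^'n^'n) \<Rightarrow> (nat \<Rightarrow> real^'m^'m) \<Rightarrow> nat \<Rightarrow> nat \<Rightarrow> real^'n^'n" where
  "closed_loop A B Q R N t = A - B ** gain A B Q R N t"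

text \<open>State transition: trans_prod D t0 k = D_(t0+k-1) ... D_(t0); Phi(t,t0) = trans_prod D t0 (t - t0).\<close>
primrec trans_prod :: "(nat \<Rightarrow> real^'n^'n) \<Rightarrow> nat \<Rightarrow> nat \<Rightarrow> real^'n^'n" where
  "trans_prod D t0 0 = mat 1"
| "trans_prod D t0 (Suc k) = D (t0 + k) ** trans_prod D t0 k"

definition Phi :: "(nat \<Rightarrow> real^'n^'n) \<Rightarrow> nat \<Rightarrow> nat \<Rightarrow> real^'n^'n" where
  "Phi D t t0 = trans_prod D t0 (t - t0)"

text \<open>Induced (spectral) matrix norm.\<close>
definition mnorm :: "real^'n^'m \<Rightarrow> real" where
  "mnorm M = onorm (\<lambda>x. M *v x)"

end

theory Submission
  imports Defs
begin

text \<open>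
  Write \<open>x\<^sup>T M x\<close> for the quadratic form of \<open>M\<close>. The Riccati map is the value of a one-step
  linear-quadratic problem: completing the square shows that
  \<open>x\<^sup>T ric(Q,R,P) x = min\<^sub>u (x\<^sup>T Q x + u\<^sup>T R u + (Ax+Bu)\<^sup>T P (Ax+Bu))\<close>, the minimum being attained
  at the LQR feedback \<open>u = -K x\<close>. Hence \<open>ric\<close> is monotone in \<open>(Q,R,P)\<close>, so all iterates \<open>P\<^sub>t\<close> of
  the time-varying recursion stay between \<open>P\<^sup>e(\<mu>\<^sub>fI,\<mu>\<^sub>gI)\<close> and \<open>P\<^sup>e(l\<^sub>fI,l\<^sub>gI)\<close>, and
  \<open>x\<^sup>T P\<^sub>t x \<ge> \<mu>\<^sub>f |x|\<^sup>2 + (D\<^sub>tx)\<^sup>T P\<^sub>t\<^sub>+\<^sub>1 (D\<^sub>tx)\<close>. As \<open>x\<^sup>T P\<^sub>t x \<le> \<upsilon>\<^sub>m\<^sub>a\<^sub>x(P\<^sup>e(l\<^sub>fI,l\<^sub>gI)) |x|\<^sup>2\<close>, the form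
  \<open>x\<^sup>T P\<^sub>t x\<close> is a Lyapunov function contracting by the factor \<open>c\<^sub>2\<^sup>2\<close> along the closed loop, and
  comparing it with \<open>|x|\<^sup>2\<close> at both ends gives the bound on \<open>\<Phi>\<close>.

  The DARE solutions themselves exist because value iteration \<open>ric\<^sup>k(0)\<close> increases and is
  bounded (by controllability, every state can be driven to zero at finite cost), and they are
  unique because the difference of two solutions is transported by a contracting closed loop.
\<close>

section \<open>Quadratic forms\<close>

declare transpose_matrix_vector [simp del]

definition qform :: "real^'n^'n \<Rightarrow> real^'n \<Rightarrow> real" where
  "qform M x = x \<bullet> (M *v x)"

lemma inner_matrix_vector_transpose:
  "(x::real^'n) \<bullet> ((M::real^'m^'n) *v y) = (transpose M *v x) \<bullet> y"
  by (metis dot_lmul_matrix transpose_matrix_vector transpose_transpose)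

lemma inner_matrix_vector_symmetric:
  "transpose M = M \<Longrightarrow> (x::real^'n) \<bullet> ((M::real^'n^'n) *v y) = (M *v x) \<bullet> y"
  by (metis inner_matrix_vector_transpose)

lemma transpose_add: "transpose (X + Y) = transpose X + transpose (Y::real^'n^'m)"
  by (simp add: transpose_def vec_eq_iff)

lemma transpose_diff: "transpose (X - Y) = transpose X - transpose (Y::real^'n^'m)"
  by (simp add: transpose_def vec_eq_iff)

lemma transpose_uminus: "transpose (- Y) = - transpose (Y::real^'n^'m)"
  by (simp add: transpose_def vec_eq_iff)

lemma matrix_vector_mult_uminus_left: "(- M) *v x = - ((M::real^'n^'m) *v x)"
  by (simp add: vec_eq_iff matrix_vector_mult_def sum_negf)

lemma matrix_vector_mult_uminus_right: "(M::real^'n^'m) *v (- x) = - (M *v x)"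
  by (simp add: vec_eq_iff matrix_vector_mult_def sum_negf)

lemma qform_add: "qform (X + Y) x = qform X x + qform Y x"
  by (simp add: qform_def matrix_vector_mult_add_rdistrib inner_add_right)

lemma qform_diff: "qform (X - Y) x = qform X x - qform Y x"
  by (simp add: qform_def matrix_vector_mult_diff_rdistrib inner_diff_right)

lemma qform_uminus: "qform (- M) x = - qform M x"
  by (simp add: qform_def matrix_vector_mult_uminus_left)

lemma qform_scaleR_mat_1: "qform (c *\<^sub>R mat 1) x = c * (x \<bullet> x)"
  by (simp add: qform_def flip: scaleR_matrix_vector_assoc)

lemma qform_zero [simp]: "qform 0 x = 0"
  by (simp add: qform_def)

lemma qform_zero_vector [simp]: "qform M 0 = 0"
  by (simp add: qform_def)

lemma qform_uminus_vector [simp]: "qform M (- x) = qform M x"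
  by (simp add: qform_def matrix_vector_mult_uminus_right)

lemma qform_scaleR_vector: "qform M (c *\<^sub>R x) = c\<^sup>2 * qform M x"
  by (simp add: qform_def matrix_vector_mult_scaleR power2_eq_square)

lemma qform_transpose_mult: "qform (transpose B ** P ** B) v = qform P (B *v v)"
  by (simp add: qform_def inner_matrix_vector_transpose flip: matrix_vector_mul_assoc)

lemma qform_eq_entries: "qform M x = (\<Sum>i\<in>UNIV. \<Sum>j\<in>UNIV. x $ i * M $ i $ j * x $ j)"
  by (simp add: qform_def inner_vec_def matrix_vector_mult_def sum_distrib_left mult.assoc)

lemma abs_qform_le_entry_sum:
  "\<bar>qform M y\<bar> \<le> (\<Sum>i\<in>UNIV. \<Sum>j\<in>UNIV. \<bar>M $ i $ j\<bar>) * (norm y)\<^sup>2"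
proof -
  have "norm (M *v y) \<le> onorm ((*v) M) * norm y"
    by (rule onorm) simp
  also have "\<dots> \<le> (\<Sum>i\<in>UNIV. \<Sum>j\<in>UNIV. \<bar>M $ i $ j\<bar>) * norm y"
    by (intro mult_right_mono onorm_le_matrix_component_sum) simp
  finally have "norm y * norm (M *v y) \<le> norm y * ((\<Sum>i\<in>UNIV. \<Sum>j\<in>UNIV. \<bar>M $ i $ j\<bar>) * norm y)"
    by (simp add: mult_left_mono)
  then show ?thesis
    using Cauchy_Schwarz_ineq2[of y "M *v y"] by (simp add: qform_def power2_eq_square mult_ac)
qed

lemma symmetric_entry_eq_polarization:
  assumes "transpose M = (M::real^'n^'n)"
  shows "M $ i $ j = (qform M (axis i 1 + axis j 1) - qform M (axis i 1) - qform M (axis j 1)) / 2"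
proof -
  have "axis i 1 \<bullet> (M *v axis j 1) = (M *v axis j 1) $ i"
    by (simp add: inner_axis')
  also have "\<dots> = M $ i $ j"
    by (simp add: matrix_vector_mult_def axis_def if_distrib cong: if_cong)
  finally have "axis i 1 \<bullet> (M *v axis j 1) = M $ i $ j" .
  moreover have "axis j 1 \<bullet> (M *v axis i 1) = axis i 1 \<bullet> (M *v axis j 1)"
    using inner_matrix_vector_symmetric[OF assms] inner_commute by metis
  ultimately show ?thesis
    by (simp add: qform_def matrix_vector_right_distrib inner_add_left inner_add_right)
qed

lemma psd_iff_qform: "psd M \<longleftrightarrow> transpose M = M \<and> (\<forall>x. 0 \<le> qform M x)"
  by (simp add: psd_def qform_def)

lemma pos_def_iff_qform: "pos_def M \<longleftrightarrow> transpose M = M \<and> (\<forall>x. x \<noteq> 0 \<longrightarrow> 0 < qform M x)"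
  by (simp add: pos_def_def qform_def)

lemma loewner_le_iff_qform:
  "loewner_le X Y \<longleftrightarrow> transpose (Y - X) = Y - X \<and> (\<forall>x. qform X x \<le> qform Y x)"
  by (simp add: loewner_le_def psd_iff_qform qform_diff)

lemma pos_def_qform_nonneg: "pos_def M \<Longrightarrow> 0 \<le> qform M x"
  unfolding pos_def_iff_qform by (cases "x = 0") (auto intro: less_imp_le)

lemma pos_def_imp_psd: "pos_def M \<Longrightarrow> psd M"
  by (simp add: pos_def_qform_nonneg psd_iff_qform pos_def_iff_qform)

lemma pos_def_if_qform_ge:
  assumes "transpose M = M" "0 < c" "\<And>x. c * (x \<bullet> x) \<le> qform M x"
  shows "pos_def M"
  unfolding pos_def_iff_qform using assms
  by (metis inner_gt_zero_iff mult_pos_pos order_less_le_trans)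

lemma invertible_if_pos_def:
  assumes "pos_def (S::real^'n^'n)"
  shows "invertible S"
proof -
  have "\<forall>x. S *v x = 0 \<longrightarrow> x = 0"
    using assms unfolding pos_def_iff_qform qform_def by (metis inner_zero_right less_irrefl)
  then show ?thesis
    using matrix_left_invertible_ker invertible_left_inverse by blast
qed

lemma matrix_inv_right:
  assumes "invertible (S::real^'n^'n)"
  shows "S ** matrix_inv S = mat 1"
  using someI_ex[OF assms[unfolded invertible_def]] unfolding matrix_inv_def by auto

lemma transpose_matrix_inv_symmetric:
  assumes "invertible (S::real^'n^'n)" "transpose S = S"
  shows "transpose (matrix_inv S) = matrix_inv S"
proof -
  have left_inv: "transpose (matrix_inv S) ** S = mat 1"
    by (metis assms(2) matrix_inv_right[OF assms(1)] matrix_transpose_mul transpose_mat)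
  have "transpose (matrix_inv S) = transpose (matrix_inv S) ** (S ** matrix_inv S)"
    by (simp add: matrix_inv_right[OF assms(1)])
  also have "\<dots> = matrix_inv S"
    using left_inv by (simp add: matrix_mul_assoc)
  finally show ?thesis .
qed

section \<open>The Riccati map as a one-step LQR value\<close>

lemma ric_completion_of_squares:
  fixes A :: "real^'n^'n" and B :: "real^'m^'n" and Q P :: "real^'n^'n" and R :: "real^'m^'m"
  assumes symP: "transpose P = P" and symR: "transpose R = R"
    and inv: "invertible (transpose B ** P ** B + R)"
  shows "qform Q x + qform R u + qform P (A *v x + B *v u) =
         qform (ric A B Q R P) x + qform (transpose B ** P ** B + R)
             (u + matrix_inv (transpose B ** P ** B + R) *v (transpose B *v (P *v (A *v x))))"
proof -
  define S where "S = transpose B ** P ** B + R"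
  define Si where "Si = matrix_inv S"
  define g where "g = transpose B *v (P *v (A *v x))"
  define a where "a = A *v x"
  define b where "b = B *v u"
  have symS: "transpose S = S"
    unfolding S_def by (simp add: transpose_add matrix_transpose_mul symP symR matrix_mul_assoc)
  have S_Si: "S *v (Si *v v) = v" for v
    using matrix_inv_right[OF inv[folded S_def]] by (simp add: Si_def matrix_vector_mul_assoc)
  have cross: "(P *v a) \<bullet> (B *v z) = g \<bullet> z" for z
    by (simp add: inner_matrix_vector_transpose g_def a_def)
  have ric_x: "qform (ric A B Q R P) x = qform Q x + a \<bullet> (P *v a) - g \<bullet> (Si *v g)"
  proof -
    have "ric A B Q R P *v x = Q *v x + transpose A *v (P *v a - P *v (B *v (Si *v g)))"
      by (simp add: ric_def matrix_vector_mult_add_rdistrib matrix_vector_mult_diff_rdistrib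
          a_def g_def Si_def S_def flip: matrix_vector_mul_assoc)
    then have "qform (ric A B Q R P) x = qform Q x + a \<bullet> (P *v a - P *v (B *v (Si *v g)))"
      by (simp add: qform_def inner_add_right inner_matrix_vector_transpose a_def)
    moreover have "a \<bullet> (P *v (B *v (Si *v g))) = g \<bullet> (Si *v g)"
      using cross inner_matrix_vector_symmetric[OF symP] by metis
    ultimately show ?thesis by (simp add: inner_diff_right)
  qed
  have square: "qform S (u + Si *v g) = u \<bullet> (S *v u) + 2 * (u \<bullet> g) + g \<bullet> (Si *v g)"
  proof -
    have "qform S (u + Si *v g) = u \<bullet> (S *v u) + u \<bullet> (S *v (Si *v g)) + (Si *v g) \<bullet> (S *v u)
        + (Si *v g) \<bullet> (S *v (Si *v g))"
      by (simp add: qform_def matrix_vector_right_distrib inner_add_left inner_add_right)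
    also have "(Si *v g) \<bullet> (S *v u) = g \<bullet> u"
      using inner_matrix_vector_symmetric[OF symS, of "Si *v g" u] S_Si by simp
    finally show ?thesis using S_Si by (simp add: inner_commute)
  qed
  have u_S_u: "u \<bullet> (S *v u) = b \<bullet> (P *v b) + qform R u"
    by (simp add: S_def qform_def matrix_vector_mult_add_rdistrib inner_add_right
        inner_matrix_vector_transpose b_def flip: matrix_vector_mul_assoc)
  have next_state: "qform P (a + b) = a \<bullet> (P *v a) + 2 * (u \<bullet> g) + b \<bullet> (P *v b)"
  proof -
    have "qform P (a + b) = a \<bullet> (P *v a) + a \<bullet> (P *v b) + b \<bullet> (P *v a) + b \<bullet> (P *v b)"
      by (simp add: qform_def matrix_vector_right_distrib inner_add_left inner_add_right)
    moreover have "a \<bullet> (P *v b) = g \<bullet> u"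
      using cross inner_matrix_vector_symmetric[OF symP] b_def by metis
    moreover have "b \<bullet> (P *v a) = g \<bullet> u"
      using cross[of u] b_def by (simp add: inner_commute)
    ultimately show ?thesis by (simp add: inner_commute)
  qed
  have "transpose B *v (P *v (A *v x)) = g"
    by (simp add: g_def)
  then show ?thesis
    using ric_x square u_S_u next_state unfolding S_def[symmetric] Si_def[symmetric]
      a_def[symmetric] b_def[symmetric] by simp
qed

lemma pos_def_riccati_weight:
  assumes "pos_def R" "psd P"
  shows "pos_def (transpose B ** P ** B + R)"
  using assms unfolding pos_def_iff_qform psd_iff_qform
  by (auto simp: transpose_add matrix_transpose_mul matrix_mul_assoc qform_add qform_transpose_mult
      intro: add_nonneg_pos)

lemma ric_symmetric:
  assumes "transpose Q = Q" "pos_def R" "psd P"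
  shows "transpose (ric A B Q R P) = ric A B Q R P"
proof -
  have S: "pos_def (transpose B ** P ** B + R)"
    by (rule pos_def_riccati_weight[OF assms(2,3)])
  have "transpose (matrix_inv (transpose B ** P ** B + R)) = matrix_inv (transpose B ** P ** B + R)"
    using S invertible_if_pos_def[OF S] unfolding pos_def_iff_qform
    by (blast intro: transpose_matrix_inv_symmetric)
  then show ?thesis
    using assms unfolding pos_def_iff_qform psd_iff_qform
    by (simp add: ric_def transpose_add transpose_diff matrix_transpose_mul matrix_mul_assoc)
qed

definition lqr_gain :: "real^'n^'n \<Rightarrow> real^'m^'n \<Rightarrow> real^'m^'m \<Rightarrow> real^'n^'n \<Rightarrow> real^'n^'m" where
  "lqr_gain A B R P = matrix_inv (R + transpose B ** P ** B) ** transpose B ** P ** A"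

lemma ric_le_stage_cost:
  assumes "pos_def R" "psd P"
  shows "qform (ric A B Q R P) x \<le> qform Q x + qform R u + qform P (A *v x + B *v u)"
proof -
  have S: "pos_def (transpose B ** P ** B + R)"
    by (rule pos_def_riccati_weight[OF assms])
  have "transpose P = P" "transpose R = R"
    using assms unfolding pos_def_iff_qform psd_iff_qform by auto
  then show ?thesis
    using ric_completion_of_squares[OF _ _ invertible_if_pos_def[OF S], of Q x u A]
      pos_def_qform_nonneg[OF S] by (smt (verit))
qed

lemma closed_loop_eq: "A *v x + B *v (- (K *v x)) = (A - B ** K) *v (x::real^'n)"
  by (simp add: matrix_vector_mult_diff_rdistrib matrix_vector_mult_uminus_right
      flip: matrix_vector_mul_assoc)

lemma ric_eq_lqr_cost:
  assumes "pos_def R" "psd P"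
  shows "qform (ric A B Q R P) x = qform Q x + qform R (lqr_gain A B R P *v x)
           + qform P ((A - B ** lqr_gain A B R P) *v x)"
proof -
  have sym: "transpose P = P" "transpose R = R"
    using assms unfolding pos_def_iff_qform psd_iff_qform by auto
  have "- (lqr_gain A B R P *v x)
      + matrix_inv (transpose B ** P ** B + R) *v (transpose B *v (P *v (A *v x))) = 0"
    by (simp add: lqr_gain_def add.commute flip: matrix_vector_mul_assoc)
  then show ?thesis
    using ric_completion_of_squares[OF sym invertible_if_pos_def[OF pos_def_riccati_weight[OF assms]],
        of Q x "- (lqr_gain A B R P *v x)" A]
    by (simp add: closed_loop_eq)
qed

lemma ric_mono:
  assumes "pos_def R1" "psd P1" "pos_def R2" "psd P2"
    and "\<And>x. qform Q1 x \<le> qform Q2 x" "\<And>u. qform R1 u \<le> qform R2 u"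
    and "\<And>y. qform P1 y \<le> qform P2 y"
  shows "qform (ric A B Q1 R1 P1) x \<le> qform (ric A B Q2 R2 P2) x"
proof -
  define K where "K = lqr_gain A B R2 P2"
  have "qform (ric A B Q1 R1 P1) x
      \<le> qform Q1 x + qform R1 (- (K *v x)) + qform P1 (A *v x + B *v (- (K *v x)))"
    by (rule ric_le_stage_cost[OF assms(1,2)])
  also have "\<dots> \<le> qform Q2 x + qform R2 (- (K *v x)) + qform P2 (A *v x + B *v (- (K *v x)))"
    using assms(5-7) by (meson add_mono)
  also have "\<dots> = qform (ric A B Q2 R2 P2) x"
    using ric_eq_lqr_cost[OF assms(3,4), of A B Q2 x] by (simp add: K_def closed_loop_eq)
  finally show ?thesis .
qed

lemma qform_le_ric:
  assumes "pos_def R" "psd P"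
  shows "qform Q x \<le> qform (ric A B Q R P) x"
  using ric_eq_lqr_cost[OF assms, of A B Q x] pos_def_qform_nonneg[OF assms(1)] assms(2)
  unfolding psd_iff_qform by (smt (verit))

lemma ric_closed_loop_contraction:
  assumes "pos_def R" "psd P'" "P = ric A B Q R P'"
    and "\<And>x. q * (x \<bullet> x) \<le> qform Q x" "0 \<le> q"
    and "\<And>x. qform P x \<le> lam * (x \<bullet> x)" "0 < lam"
  shows "qform P' ((A - B ** lqr_gain A B R P') *v x) \<le> (1 - q / lam) * qform P x"
proof -
  have "qform P' ((A - B ** lqr_gain A B R P') *v x) \<le> qform P x - q * (x \<bullet> x)"
    using ric_eq_lqr_cost[OF assms(1,2), of A B Q x] assms(3,4)
      pos_def_qform_nonneg[OF assms(1)] by (smt (verit))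
  moreover have "q / lam * qform P x \<le> q / lam * (lam * (x \<bullet> x))"
    using assms(5-7) by (intro mult_left_mono) auto
  ultimately show ?thesis
    using assms(7) by (simp add: algebra_simps)
qed

section \<open>Extreme eigenvalues of symmetric matrices\<close>

lemma quadratic_nonneg_imp_linear_coeff_zero:
  fixes a b :: real
  assumes "0 \<le> a" "0 \<le> b" "\<And>t. 0 \<le> 2 * t * a + t\<^sup>2 * b"
  shows "a = 0"
proof (rule ccontr)
  assume "a \<noteq> 0"
  with assms(1) have "0 < a" by simp
  define t where "t = - a / (b + 1)"
  have tb: "t * (b + 1) = - a"
    using assms(2) by (simp add: t_def)
  have "(2 * t * a + t\<^sup>2 * b) * (b + 1)\<^sup>2 = 2 * a * (b + 1) * (t * (b + 1)) + b * (t * (b + 1))\<^sup>2"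
    by (simp add: power2_eq_square algebra_simps)
  also have "\<dots> = - (a\<^sup>2 * (b + 2))"
    unfolding tb by (simp add: power2_eq_square algebra_simps)
  finally have "(2 * t * a + t\<^sup>2 * b) * (b + 1)\<^sup>2 = - (a\<^sup>2 * (b + 2))" .
  moreover have "0 \<le> (2 * t * a + t\<^sup>2 * b) * (b + 1)\<^sup>2"
    using assms(3) by simp
  moreover have "0 < a\<^sup>2 * (b + 2)"
    using \<open>0 < a\<close> assms(2) by (intro mult_pos_pos) auto
  ultimately show False by linarith
qed

lemma psd_qform_zero_imp_kernel:
  assumes sym: "transpose N = N" and nonneg: "\<And>x. 0 \<le> qform N x" and zero: "qform N v = 0"
  shows "N *v v = (0::real^'n)"
proof -
  define w where "w = N *v v"
  have "qform N (v + t *\<^sub>R w) = 2 * t * (w \<bullet> w) + t\<^sup>2 * qform N w" for t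
  proof -
    have "qform N (v + t *\<^sub>R w)
        = qform N v + t * (v \<bullet> (N *v w)) + t * (w \<bullet> (N *v v)) + t\<^sup>2 * qform N w"
      by (simp add: qform_def matrix_vector_right_distrib matrix_vector_mult_scaleR inner_add_left
          inner_add_right power2_eq_square algebra_simps)
    moreover have "v \<bullet> (N *v w) = w \<bullet> (N *v v)"
      using inner_matrix_vector_symmetric[OF sym] inner_commute by metis
    ultimately show ?thesis using zero by (simp add: w_def)
  qed
  then have "0 \<le> 2 * t * (w \<bullet> w) + t\<^sup>2 * qform N w" for t
    using nonneg by metis
  then have "w \<bullet> w = 0"
    by (rule quadratic_nonneg_imp_linear_coeff_zero[OF inner_ge_zero nonneg])
  then show ?thesis by (simp add: w_def)
qed

lemma symmetric_eq_if_qform_eq: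
  fixes M N :: "real^'n^'n"
  assumes "transpose M = M" "transpose N = N" "\<And>x. qform M x = qform N x"
  shows "M = N"
proof -
  have "(M - N) *v v = 0" for v
    using assms by (intro psd_qform_zero_imp_kernel) (simp_all add: transpose_diff qform_diff)
  then show ?thesis by (simp add: matrix_eq matrix_vector_mult_diff_rdistrib)
qed

text \<open>The maximiser of \<open>x\<^sup>T M x\<close> on the unit sphere is an eigenvector, because
  \<open>\<lambda> I - M\<close> is then positive semidefinite with that vector in the null set of its form.\<close>

lemma rayleigh_max:
  fixes M :: "real^'n^'n"
  assumes sym: "transpose M = M"
  shows "\<exists>l\<in>eigenvalues M. \<forall>x. qform M x \<le> l * (x \<bullet> x)"
proof -
  have "continuous_on (sphere (0::real^'n) 1) (qform M)"
    unfolding qform_def by (intro continuous_intros)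
  then obtain v where v: "v \<in> sphere 0 1"
    and vmax: "\<And>y. y \<in> sphere 0 1 \<Longrightarrow> qform M y \<le> qform M v"
    using continuous_attains_sup[of "sphere (0::real^'n) 1" "qform M"] compact_sphere
    by (metis empty_iff mem_sphere_0 norm_axis_1)
  define l where "l = qform M v"
  have bound: "qform M x \<le> l * (x \<bullet> x)" for x
  proof (cases "x = 0")
    case False
    define y where "y = (1 / norm x) *\<^sub>R x"
    have "qform M y \<le> l"
      using False vmax by (simp add: y_def l_def)
    moreover have "qform M y = qform M x / (x \<bullet> x)"
      using False by (simp add: y_def qform_scaleR_vector power_one_over dot_square_norm divide_simps)
    ultimately show ?thesis
      using False by (simp add: divide_le_eq)
  qed simp
  define N where "N = l *\<^sub>R mat 1 - M"
  have "N *v v = 0"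
  proof (rule psd_qform_zero_imp_kernel)
    show "transpose N = N" by (simp add: N_def transpose_diff transpose_scalar sym)
    show "0 \<le> qform N x" for x using bound[of x] by (simp add: N_def qform_diff qform_scaleR_mat_1)
    show "qform N v = 0"
      using v by (simp add: N_def qform_diff qform_scaleR_mat_1 l_def dot_square_norm)
  qed
  then have "M *v v = l *\<^sub>R v"
    by (simp add: N_def matrix_vector_mult_diff_rdistrib flip: scaleR_matrix_vector_assoc)
  moreover have "v \<noteq> 0" using v by auto
  ultimately have "l \<in> eigenvalues M" unfolding eigenvalues_def by blast
  then show ?thesis using bound by blast
qed

lemma eigenvalues_uminus_iff: "l \<in> eigenvalues (- M) \<longleftrightarrow> - l \<in> eigenvalues (M::real^'n^'n)"
proof -
  have "(- M) *v v = l *\<^sub>R v \<longleftrightarrow> M *v v = (- l) *\<^sub>R v" for v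
    unfolding matrix_vector_mult_uminus_left by (metis minus_equation_iff scaleR_minus_left)
  then show ?thesis
    unfolding eigenvalues_def by simp
qed

lemma rayleigh_min:
  fixes M :: "real^'n^'n"
  assumes "transpose M = M"
  shows "\<exists>l\<in>eigenvalues M. \<forall>x. l * (x \<bullet> x) \<le> qform M x"
proof -
  obtain l where l: "l \<in> eigenvalues (- M)" "\<And>x. qform (- M) x \<le> l * (x \<bullet> x)"
    using rayleigh_max[of "- M"] assms by (auto simp: transpose_uminus)
  have "(- l) * (x \<bullet> x) \<le> qform M x" for x
    using l(2)[of x] by (simp add: qform_uminus)
  moreover have "- l \<in> eigenvalues M"
    using l(1) by (simp add: eigenvalues_uminus_iff)
  ultimately show ?thesis by blast
qed

text \<open>Eigenvectors of distinct eigenvalues of a symmetric matrix are orthogonal, so there are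
  at most \<open>n\<close> eigenvalues; without finiteness \<open>eig_max\<close> and \<open>eig_min\<close> would be junk.\<close>

lemma finite_eigenvalues:
  fixes M :: "real^'n^'n"
  assumes sym: "transpose M = M"
  shows "finite (eigenvalues M)"
proof (rule ccontr)
  assume "infinite (eigenvalues M)"
  then obtain F where F: "finite F" "card F = Suc CARD('n)" "F \<subseteq> eigenvalues M"
    using infinite_arbitrarily_large by blast
  define ev where "ev l = (SOME v. v \<noteq> 0 \<and> M *v v = l *\<^sub>R v)" for l
  have ev: "ev l \<noteq> 0 \<and> M *v ev l = l *\<^sub>R ev l" if "l \<in> F" for l
  proof -
    have "\<exists>v. v \<noteq> 0 \<and> M *v v = l *\<^sub>R v"
      using that F(3) by (auto simp: eigenvalues_def)
    then show ?thesis unfolding ev_def by (rule someI_ex)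
  qed
  have orth: "ev l \<bullet> ev m = 0" if "l \<in> F" "m \<in> F" "l \<noteq> m" for l m
  proof -
    have "l * (ev l \<bullet> ev m) = (M *v ev l) \<bullet> ev m" using ev that by auto
    also have "\<dots> = ev l \<bullet> (M *v ev m)" by (rule inner_matrix_vector_symmetric[OF sym, symmetric])
    also have "\<dots> = m * (ev l \<bullet> ev m)" using ev that by auto
    finally show ?thesis using that(3) by simp
  qed
  have inj: "inj_on ev F"
  proof (rule inj_onI)
    fix l m assume "l \<in> F" "m \<in> F" "ev l = ev m"
    then have "l *\<^sub>R ev l = m *\<^sub>R ev l" "ev l \<noteq> 0" using ev by metis+
    then show "l = m" by simp
  qed
  have "pairwise orthogonal (ev ` F)"
    unfolding pairwise_def orthogonal_def using orth by force
  moreover have "0 \<notin> ev ` F" using ev by auto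
  ultimately have "independent (ev ` F)" by (rule pairwise_orthogonal_independent)
  then have "card (ev ` F) \<le> CARD('n)" using independent_bound by fastforce
  then show False using card_image[OF inj] F(2) by simp
qed

lemma qform_le_eig_max:
  assumes "transpose M = M"
  shows "qform M x \<le> eig_max M * (x \<bullet> x)"
proof -
  obtain l where l: "l \<in> eigenvalues M" "\<And>x. qform M x \<le> l * (x \<bullet> x)"
    using rayleigh_max[OF assms] by blast
  have "l \<le> eig_max M"
    unfolding eig_max_def using finite_eigenvalues[OF assms] l(1) by simp
  then have "l * (x \<bullet> x) \<le> eig_max M * (x \<bullet> x)"
    by (rule mult_right_mono) simp
  then show ?thesis using l(2)[of x] by linarith
qed

lemma eig_min_le_qform:
  assumes "transpose M = M"
  shows "eig_min M * (x \<bullet> x) \<le> qform M x"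
proof -
  obtain l where l: "l \<in> eigenvalues M" "\<And>x. l * (x \<bullet> x) \<le> qform M x"
    using rayleigh_min[OF assms] by blast
  have "eig_min M \<le> l"
    unfolding eig_min_def using finite_eigenvalues[OF assms] l(1) by simp
  then have "eig_min M * (x \<bullet> x) \<le> l * (x \<bullet> x)"
    by (rule mult_right_mono) simp
  then show ?thesis using l(2)[of x] by linarith
qed

lemma eig_min_ge_if_qform_ge:
  assumes "transpose M = M" "\<And>x. c * (x \<bullet> x) \<le> qform M x"
  shows "c \<le> eig_min M"
proof -
  have "c \<le> l" if "l \<in> eigenvalues M" for l
  proof -
    from that obtain v where v: "v \<noteq> 0" "M *v v = l *\<^sub>R v"
      by (auto simp: eigenvalues_def)
    then have "c * (v \<bullet> v) \<le> l * (v \<bullet> v)"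
      using assms(2)[of v] by (simp add: qform_def)
    moreover have "0 < v \<bullet> v" using v(1) by simp
    ultimately show ?thesis by (simp add: mult_le_cancel_right_pos)
  qed
  moreover obtain l0 where "l0 \<in> eigenvalues M"
    using rayleigh_max[OF assms(1)] by blast
  ultimately show ?thesis
    unfolding eig_min_def using finite_eigenvalues[OF assms(1)] by (subst Min_ge_iff) auto
qed

lemma eig_max_ge_if_qform_ge:
  fixes M :: "real^'n^'n"
  assumes "transpose M = M" "\<And>x. c * (x \<bullet> x) \<le> qform M x"
  shows "c \<le> eig_max M"
proof -
  define e where "e = (axis undefined 1::real^'n)"
  have "e \<bullet> e = 1" by (simp add: e_def)
  then have "eig_min M \<le> qform M e" "qform M e \<le> eig_max M"
    using eig_min_le_qform[OF assms(1), of e] qform_le_eig_max[OF assms(1), of e] by simp_all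
  then show ?thesis
    using eig_min_ge_if_qform_ge[OF assms] by linarith
qed

section \<open>Lyapunov estimates and uniqueness of DARE solutions\<close>

lemma trans_prod_qform_decay:
  fixes P D :: "nat \<Rightarrow> real^'n^'n"
  assumes step: "\<And>j x. j < k \<Longrightarrow> qform (P (Suc (t0 + j))) (D (t0 + j) *v x) \<le> c * qform (P (t0 + j)) x"
    and "0 \<le> c"
  shows "qform (P (t0 + k)) (trans_prod D t0 k *v x) \<le> c ^ k * qform (P t0) x"
  using step
proof (induction k)
  case (Suc k)
  have "qform (P (t0 + Suc k)) (trans_prod D t0 (Suc k) *v x)
      = qform (P (Suc (t0 + k))) (D (t0 + k) *v (trans_prod D t0 k *v x))"
    by (simp add: matrix_vector_mul_assoc)
  also have "\<dots> \<le> c * qform (P (t0 + k)) (trans_prod D t0 k *v x)"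
    using Suc.prems by simp
  also have "\<dots> \<le> c * (c ^ k * qform (P t0) x)"
    using Suc \<open>0 \<le> c\<close> by (intro mult_left_mono) auto
  finally show ?case by simp
qed simp

lemma mnorm_le_if_qform_decay:
  assumes "0 < mu" "0 \<le> c"
    and lower: "\<And>y. mu * (y \<bullet> y) \<le> qform P' y" and upper: "\<And>x. qform P x \<le> lam * (x \<bullet> x)"
    and decay: "\<And>x. qform P' (M *v x) \<le> c * qform P x"
  shows "mnorm M \<le> sqrt (lam / mu) * sqrt c"
  unfolding mnorm_def
proof (rule onorm_le)
  fix x
  have "mu * (norm (M *v x))\<^sup>2 \<le> c * qform P x"
    using lower[of "M *v x"] decay[of x] by (simp add: dot_square_norm)
  also have "\<dots> \<le> c * (lam * (norm x)\<^sup>2)"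
    using upper[of x] \<open>0 \<le> c\<close> by (intro mult_left_mono) (simp_all add: dot_square_norm)
  finally have "(norm (M *v x))\<^sup>2 \<le> (lam / mu) * c * (norm x)\<^sup>2"
    using \<open>0 < mu\<close> by (simp add: field_simps)
  then have "norm (M *v x) \<le> sqrt ((lam / mu) * c * (norm x)\<^sup>2)"
    by (rule real_le_rsqrt)
  also have "\<dots> = sqrt (lam / mu) * sqrt c * norm x"
    by (simp only: real_sqrt_mult real_sqrt_abs abs_norm_cancel)
  finally show "norm (M *v x) \<le> sqrt (lam / mu) * sqrt c * norm x" .
qed

lemma le_zero_if_le_geometric:
  fixes a b c :: real
  assumes "\<And>k. a \<le> b * c ^ k" "0 \<le> c" "c < 1"
  shows "a \<le> 0"
proof -
  have "(\<lambda>k. b * c ^ k) \<longlonglongrightarrow> b * 0"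
    by (intro tendsto_mult tendsto_const LIMSEQ_power_zero) (use assms in simp)
  then show ?thesis
    using assms(1) by (intro LIMSEQ_le_const[of "\<lambda>k. b * c ^ k"]) auto
qed

lemma dare_solution_closed_loop_decay:
  fixes A :: "real^'n^'n" and B :: "real^'m^'n"
  assumes Q: "\<And>x. q * (x \<bullet> x) \<le> qform Q x" "0 < q" and R: "pos_def R"
    and P: "pos_def P" "P = ric A B Q R P"
  obtains c where "0 \<le> c" "c < 1"
    "\<And>k x. q * (norm (trans_prod (\<lambda>_. A - B ** lqr_gain A B R P) 0 k *v x))\<^sup>2 \<le> c ^ k * qform P x"
proof
  have sym: "transpose P = P"
    using P(1) by (simp add: pos_def_iff_qform)
  have P_ge: "q * (z \<bullet> z) \<le> qform P z" for z
    using qform_le_ric[OF R pos_def_imp_psd[OF P(1)], where Q = Q and A = A and B = B and x = z]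
      P(2) Q(1)[of z] by simp
  then have "q \<le> eig_max P"
    by (rule eig_max_ge_if_qform_ge[OF sym])
  then show c: "0 \<le> 1 - q / eig_max P" "1 - q / eig_max P < 1"
    using Q(2) by (simp_all add: field_simps)
  fix k x
  have "qform P (trans_prod (\<lambda>_. A - B ** lqr_gain A B R P) 0 k *v x) \<le> (1 - q / eig_max P) ^ k * qform P x"
    using \<open>q \<le> eig_max P\<close> Q(2) c(1)
    by (intro trans_prod_qform_decay ric_closed_loop_contraction[OF R pos_def_imp_psd[OF P(1)] P(2) Q(1)]
        qform_le_eig_max[OF sym]) auto
  then show "q * (norm (trans_prod (\<lambda>_. A - B ** lqr_gain A B R P) 0 k *v x))\<^sup>2
      \<le> (1 - q / eig_max P) ^ k * qform P x"
    using P_ge[of "trans_prod (\<lambda>_. A - B ** lqr_gain A B R P) 0 k *v x"] by (simp add: dot_square_norm)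
qed

text \<open>Two solutions are compared along the closed loop of \<open>P\<^sub>2\<close>: there \<open>x\<^sup>T(P\<^sub>1 - P\<^sub>2)x\<close>
  can only grow, while the trajectory decays geometrically.\<close>

lemma dare_solution_le:
  fixes A :: "real^'n^'n" and B :: "real^'m^'n"
  assumes Q: "\<And>x. q * (x \<bullet> x) \<le> qform Q x" "0 < q" and R: "pos_def R"
    and P1: "pos_def P1" "P1 = ric A B Q R P1"
    and P2: "pos_def P2" "P2 = ric A B Q R P2"
  shows "qform P1 x \<le> qform P2 x"
proof -
  define D where "D = A - B ** lqr_gain A B R P2"
  define y where "y k = trans_prod (\<lambda>_. D) 0 k *v x" for k
  obtain c where c: "0 \<le> c" "c < 1" and decay: "\<And>k. q * (norm (y k))\<^sup>2 \<le> c ^ k * qform P2 x"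
    using dare_solution_closed_loop_decay[OF Q R P2] unfolding y_def D_def by metis
  have "qform (P2 - P1) (D *v z) \<le> 1 * qform (P2 - P1) z" for z
    using ric_eq_lqr_cost[OF R pos_def_imp_psd[OF P2(1)], of A B Q z] P2(2)
      ric_le_stage_cost[OF R pos_def_imp_psd[OF P1(1)], of A B Q z "- (lqr_gain A B R P2 *v z)"] P1(2)
    by (simp add: D_def closed_loop_eq qform_diff)
  then have grow: "qform (P1 - P2) x \<le> qform (P1 - P2) (y k)" for k
    using trans_prod_qform_decay[of k "\<lambda>_. P2 - P1" 0 "\<lambda>_. D" 1 x]
    by (simp add: y_def qform_diff)
  define C where "C = (\<Sum>i\<in>UNIV. \<Sum>j\<in>UNIV. \<bar>(P1 - P2) $ i $ j\<bar>)"
  have "qform (P1 - P2) x \<le> C * (qform P2 x / q) * c ^ k" for k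
  proof -
    have "(norm (y k))\<^sup>2 \<le> qform P2 x / q * c ^ k"
      using decay[of k] Q(2) by (simp add: field_simps)
    then have "C * (norm (y k))\<^sup>2 \<le> C * (qform P2 x / q * c ^ k)"
      by (rule mult_left_mono) (simp add: C_def sum_nonneg)
    then show ?thesis
      using grow[of k] abs_qform_le_entry_sum[of "P1 - P2" "y k"] by (simp add: C_def mult.assoc)
  qed
  then have "qform (P1 - P2) x \<le> 0"
    using le_zero_if_le_geometric c by blast
  then show ?thesis by (simp add: qform_diff)
qed

lemma dare_solution_unique:
  fixes A :: "real^'n^'n" and B :: "real^'m^'n"
  assumes Q: "\<And>x. q * (x \<bullet> x) \<le> qform Q x" "0 < q" and R: "pos_def R"
    and P1: "pos_def P1" "P1 = ric A B Q R P1"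
    and P2: "pos_def P2" "P2 = ric A B Q R P2"
  shows "P1 = P2"
proof (rule symmetric_eq_if_qform_eq)
  show "transpose P1 = P1" "transpose P2 = P2"
    using P1(1) P2(1) unfolding pos_def_iff_qform by auto
  show "qform P1 x = qform P2 x" for x
    using dare_solution_le[OF Q R P1 P2, of x] dare_solution_le[OF Q R P2 P1, of x] by simp
qed

section \<open>Controllability\<close>

primrec state_traj :: "real^'n^'n \<Rightarrow> real^'m^'n \<Rightarrow> real^'n \<Rightarrow> (nat \<Rightarrow> real^'m) \<Rightarrow> nat \<Rightarrow> real^'n" where
  "state_traj A B x u 0 = x"
| "state_traj A B x u (Suc k) = A *v state_traj A B x u k + B *v u k"

lemma state_traj_add:
  "state_traj A B 0 (\<lambda>j. u j + v j) k = state_traj A B 0 u k + state_traj A B 0 v k"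
  by (induction k) (simp_all add: matrix_vector_right_distrib algebra_simps)

lemma state_traj_scaleR: "state_traj A B 0 (\<lambda>j. c *\<^sub>R u j) k = c *\<^sub>R state_traj A B 0 u k"
  by (induction k) (simp_all add: matrix_vector_mult_scaleR scaleR_add_right)

lemma state_traj_superposition:
  "state_traj A B x u k = state_traj A B x (\<lambda>_. 0) k + state_traj A B 0 u k"
  by (induction k) (simp_all add: matrix_vector_right_distrib algebra_simps)

lemma state_traj_impulse:
  "state_traj A B 0 (\<lambda>j. if j = m then v else 0) (Suc m + i) = ((*v) A ^^ i) (B *v v)"
proof -
  have "state_traj A B 0 (\<lambda>j. if j = m then v else 0) j = 0" if "j \<le> m" for j
    using that by (induction j) auto
  then show ?thesis by (induction i) auto
qed

lemma state_traj_cong_prefix: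
  "k \<le> n \<Longrightarrow> state_traj A B x (\<lambda>j. if j < n then u j else 0) k = state_traj A B x u k"
  by (induction k) auto

lemma controllable_reachable:
  fixes A :: "real^'n^'n" and B :: "real^'m^'n"
  assumes "controllable A B"
  shows "\<exists>u. state_traj A B 0 u CARD('n) = y"
proof -
  define S where "S = range (\<lambda>u. state_traj A B 0 u CARD('n))"
  have "subspace S"
    unfolding subspace_def
  proof (intro conjI ballI allI)
    show "0 \<in> S"
      using state_traj_scaleR[of A B 0 "\<lambda>_. 0" "CARD('n)"] by (simp add: S_def)
    show "x + y \<in> S" if "x \<in> S" "y \<in> S" for x y
    proof -
      from that obtain u v where "x = state_traj A B 0 u CARD('n)" "y = state_traj A B 0 v CARD('n)"
        by (auto simp: S_def)
      then have "x + y = state_traj A B 0 (\<lambda>j. u j + v j) CARD('n)"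
        by (simp add: state_traj_add)
      then show ?thesis by (simp add: S_def)
    qed
    show "c *\<^sub>R x \<in> S" if "x \<in> S" for c x
    proof -
      from that obtain u where "x = state_traj A B 0 u CARD('n)"
        by (auto simp: S_def)
      then have "c *\<^sub>R x = state_traj A B 0 (\<lambda>j. c *\<^sub>R u j) CARD('n)"
        by (simp add: state_traj_scaleR)
      then show ?thesis by (simp add: S_def)
    qed
  qed
  moreover have "(\<Union>k<CARD('n). range (\<lambda>u. ((*v) A ^^ k) (B *v u))) \<subseteq> S"
  proof safe
    fix k v assume "k < CARD('n)"
    then have "Suc (CARD('n) - Suc k) + k = CARD('n)" by simp
    then show "((*v) A ^^ k) (B *v v) \<in> S"
      unfolding S_def using state_traj_impulse[of A B "CARD('n) - Suc k" v k] by (metis rangeI)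
  qed
  ultimately have "UNIV \<subseteq> S"
    using assms span_minimal unfolding controllable_def by metis
  then show ?thesis unfolding S_def by (metis UNIV_I rangeE subsetD)
qed

lemma controllable_steer_to_zero:
  fixes A :: "real^'n^'n" and B :: "real^'m^'n"
  assumes "controllable A B"
  shows "\<exists>u. (\<forall>j\<ge>CARD('n). u j = 0) \<and> (\<forall>k\<ge>CARD('n). state_traj A B x u k = 0)"
proof -
  obtain u where u: "state_traj A B 0 u CARD('n) = - state_traj A B x (\<lambda>_. 0) CARD('n)"
    using controllable_reachable[OF assms] by blast
  define u' where "u' j = (if j < CARD('n) then u j else 0)" for j
  have "state_traj A B x u' CARD('n) = state_traj A B x u CARD('n)"
    unfolding u'_def by (rule state_traj_cong_prefix) simp
  also have "\<dots> = 0"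
    using state_traj_superposition[of A B x u] u by simp
  finally have zero: "state_traj A B x u' CARD('n) = 0" .
  have u'_zero: "\<forall>j\<ge>CARD('n). u' j = 0"
    by (simp add: u'_def)
  have "state_traj A B x u' k = 0" if "CARD('n) \<le> k" for k
    using that by (induction k rule: dec_induct) (simp_all add: zero u'_zero)
  with u'_zero show ?thesis by blast
qed

section \<open>Existence of DARE solutions by value iteration\<close>

context
  fixes A :: "real^'n^'n" and B :: "real^'m^'n" and Q :: "real^'n^'n" and R :: "real^'m^'m"
    and q r :: real
  assumes controllable: "controllable A B"
    and Q_sym: "transpose Q = Q" and q_pos: "0 < q" and Q_ge: "\<And>x. q * (x \<bullet> x) \<le> qform Q x"
    and R_pos_def: "pos_def R" and r_pos: "0 < r" and R_ge: "\<And>u. r * (u \<bullet> u) \<le> qform R u"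
begin

definition value_iter :: "nat \<Rightarrow> real^'n^'n" where
  "value_iter k = (ric A B Q R ^^ k) 0"

lemma value_iter_Suc: "value_iter (Suc k) = ric A B Q R (value_iter k)"
  by (simp add: value_iter_def)

lemma qform_Q_nonneg: "0 \<le> qform Q x"
  using Q_ge[of x] q_pos by (smt (verit) inner_ge_zero mult_nonneg_nonneg)

lemma psd_value_iter: "psd (value_iter k)"
proof (induction k)
  case 0
  then show ?case by (simp add: value_iter_def psd_iff_qform transpose_def vec_eq_iff)
next
  case (Suc k)
  then show ?case
    unfolding psd_iff_qform value_iter_Suc
    using ric_symmetric[OF Q_sym R_pos_def Suc] qform_le_ric[OF R_pos_def Suc] qform_Q_nonneg
    by (meson order_trans)
qed

lemma value_iter_symmetric: "transpose (value_iter k) = value_iter k"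
  using psd_value_iter unfolding psd_iff_qform by simp

lemma value_iter_mono: "qform (value_iter k) x \<le> qform (value_iter (Suc k)) x"
proof (induction k arbitrary: x)
  case 0
  then show ?case using psd_value_iter[of 1] by (simp add: value_iter_def psd_iff_qform)
next
  case (Suc k)
  show ?case
    unfolding value_iter_Suc[of "Suc k"] value_iter_Suc[of k]
    by (rule ric_mono[OF R_pos_def psd_value_iter R_pos_def])
      (use psd_value_iter[of "Suc k"] Suc in \<open>simp_all add: value_iter_Suc\<close>)
qed

lemma value_iter_le_cost:
  "qform (value_iter k) x \<le> (\<Sum>j<k. qform Q (state_traj A B x u j) + qform R (u j))"
proof (induction k arbitrary: x u)
  case 0
  then show ?case by (simp add: value_iter_def)
next
  case (Suc k)
  have shift: "state_traj A B (A *v x + B *v u 0) (\<lambda>j. u (Suc j)) j = state_traj A B x u (Suc j)" for j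
    by (induction j) auto
  have "qform (value_iter (Suc k)) x
      \<le> qform Q x + qform R (u 0) + qform (value_iter k) (A *v x + B *v u 0)"
    unfolding value_iter_Suc by (rule ric_le_stage_cost[OF R_pos_def psd_value_iter])
  also have "qform (value_iter k) (A *v x + B *v u 0)
      \<le> (\<Sum>j<k. qform Q (state_traj A B x u (Suc j)) + qform R (u (Suc j)))"
    using Suc[of "A *v x + B *v u 0" "\<lambda>j. u (Suc j)"] by (simp add: shift)
  moreover have "(\<Sum>j<Suc k. qform Q (state_traj A B x u j) + qform R (u j))
      = qform Q x + qform R (u 0) + (\<Sum>j<k. qform Q (state_traj A B x u (Suc j)) + qform R (u (Suc j)))"
    by (subst sum.lessThan_Suc_shift) simp
  ultimately show ?case by simp
qed

lemma value_iter_bounded: "\<exists>J. \<forall>k. qform (value_iter k) x \<le> J"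
proof -
  obtain u where u: "\<forall>j\<ge>CARD('n). u j = 0" "\<forall>k\<ge>CARD('n). state_traj A B x u k = 0"
    using controllable_steer_to_zero[OF controllable] by blast
  define c where "c j = qform Q (state_traj A B x u j) + qform R (u j)" for j
  have "qform (value_iter k) x \<le> (\<Sum>j<CARD('n). c j)" for k
  proof -
    have "qform (value_iter k) x \<le> (\<Sum>j<k. c j)"
      using value_iter_le_cost[of k x u] by (simp add: c_def)
    also have "\<dots> \<le> (\<Sum>j<max k CARD('n). c j)"
      using qform_Q_nonneg pos_def_qform_nonneg[OF R_pos_def]
      by (intro sum_mono2) (auto simp: c_def)
    also have "\<dots> = (\<Sum>j<CARD('n). c j)"
      using u by (intro sum.mono_neutral_left[symmetric]) (auto simp: c_def)
    finally show ?thesis .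
  qed
  then show ?thesis by blast
qed

definition value_limit_qform :: "real^'n \<Rightarrow> real" where
  "value_limit_qform x = lim (\<lambda>k. qform (value_iter k) x)"

lemma value_iter_qform_tendsto: "(\<lambda>k. qform (value_iter k) x) \<longlonglongrightarrow> value_limit_qform x"
proof -
  have "incseq (\<lambda>k. qform (value_iter k) x)"
    by (rule incseq_SucI) (rule value_iter_mono)
  then have "convergent (\<lambda>k. qform (value_iter k) x)"
    using value_iter_bounded incseq_convergent by (metis convergent_def)
  then show ?thesis
    unfolding value_limit_qform_def by (simp add: convergent_LIMSEQ_iff)
qed

definition value_limit :: "real^'n^'n" where
  "value_limit = (\<chi> i j. (value_limit_qform (axis i 1 + axis j 1)
      - value_limit_qform (axis i 1) - value_limit_qform (axis j 1)) / 2)"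

lemma value_iter_entry_tendsto: "(\<lambda>k. value_iter k $ i $ j) \<longlonglongrightarrow> value_limit $ i $ j"
  unfolding value_limit_def symmetric_entry_eq_polarization[OF value_iter_symmetric]
  by (auto intro!: tendsto_intros value_iter_qform_tendsto)

lemma value_iter_qform_tendsto_limit: "(\<lambda>k. qform (value_iter k) x) \<longlonglongrightarrow> qform value_limit x"
  unfolding qform_eq_entries by (intro tendsto_intros value_iter_entry_tendsto)

lemma value_limit_symmetric: "transpose value_limit = value_limit"
  unfolding value_limit_def transpose_def by (simp add: vec_eq_iff add.commute)

lemma value_iter_le_limit: "qform (value_iter k) x \<le> qform value_limit x"
proof -
  have "incseq (\<lambda>k. qform (value_iter k) x)"
    by (rule incseq_SucI) (rule value_iter_mono)
  then show ?thesis
    using incseq_le value_iter_qform_tendsto_limit by blast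
qed

lemma value_limit_ge: "q * (x \<bullet> x) \<le> qform value_limit x"
  using Q_ge[of x] value_iter_le_limit[of 1 x]
    qform_le_ric[OF R_pos_def psd_value_iter[of 0], where Q = Q and A = A and B = B and x = x]
  by (simp add: value_iter_Suc[of 0, simplified])

lemma pos_def_value_limit: "pos_def value_limit"
  using value_limit_symmetric q_pos value_limit_ge by (rule pos_def_if_qform_ge)

lemma value_limit_le_ric: "qform value_limit x \<le> qform (ric A B Q R value_limit) x"
proof -
  have "qform (value_iter (Suc k)) x \<le> qform (ric A B Q R value_limit) x" for k
    unfolding value_iter_Suc
    by (rule ric_mono[OF R_pos_def psd_value_iter R_pos_def pos_def_imp_psd[OF pos_def_value_limit]])
      (simp_all add: value_iter_le_limit)
  moreover have "(\<lambda>k. qform (value_iter (Suc k)) x) \<longlonglongrightarrow> qform value_limit x"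
    using value_iter_qform_tendsto_limit by (rule LIMSEQ_Suc)
  ultimately show ?thesis
    by (intro LIMSEQ_le_const2[of "\<lambda>k. qform (value_iter (Suc k)) x"]) auto
qed

text \<open>The bound is uniform in \<open>k\<close>, which is what allows passing to the limit in the completion
  of squares.\<close>

lemma value_iter_closed_loop_bounded:
  "norm ((A - B ** lqr_gain A B R (value_iter k)) *v x)
    \<le> norm (A *v x) + onorm ((*v) B) * sqrt (qform value_limit x / r)"
proof -
  define v where "v = lqr_gain A B R (value_iter k) *v x"
  have "qform R v \<le> qform (value_iter (Suc k)) x"
    using ric_eq_lqr_cost[OF R_pos_def psd_value_iter[of k], of A B Q x] qform_Q_nonneg[of x]
      psd_value_iter[of k]
    unfolding value_iter_Suc psd_iff_qform v_def by (smt (verit))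
  then have "r * (norm v)\<^sup>2 \<le> qform value_limit x"
    using R_ge[of v] value_iter_le_limit[of "Suc k" x] by (simp add: dot_square_norm)
  then have "(norm v)\<^sup>2 \<le> qform value_limit x / r"
    using r_pos by (simp add: field_simps)
  then have v_bound: "norm v \<le> sqrt (qform value_limit x / r)"
    by (rule real_le_rsqrt)
  have "norm ((A - B ** lqr_gain A B R (value_iter k)) *v x) \<le> norm (A *v x) + norm (B *v v)"
    by (simp add: v_def matrix_vector_mult_diff_rdistrib norm_triangle_ineq4
        flip: matrix_vector_mul_assoc)
  also have "norm (B *v v) \<le> onorm ((*v) B) * norm v"
    by (rule onorm) simp
  also have "\<dots> \<le> onorm ((*v) B) * sqrt (qform value_limit x / r)"
    using v_bound by (intro mult_left_mono onorm_pos_le) simp_all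
  finally show ?thesis by simp
qed

lemma ric_le_value_limit: "qform (ric A B Q R value_limit) x \<le> qform value_limit x"
proof -
  define E where "E k = (\<Sum>i\<in>UNIV. \<Sum>j\<in>UNIV. \<bar>(value_limit - value_iter k) $ i $ j\<bar>)" for k
  have "(\<lambda>k. \<Sum>i\<in>UNIV. \<Sum>j\<in>UNIV. \<bar>value_limit $ i $ j - value_iter k $ i $ j\<bar>)
      \<longlonglongrightarrow> (\<Sum>i\<in>(UNIV::'n set). \<Sum>j\<in>(UNIV::'n set). 0)"
  proof (intro tendsto_sum tendsto_rabs_zero)
    show "(\<lambda>k. value_limit $ i $ j - value_iter k $ i $ j) \<longlonglongrightarrow> 0" for i j
      using tendsto_diff[OF tendsto_const value_iter_entry_tendsto, of "value_limit $ i $ j" i j] by simp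
  qed
  then have E_tendsto: "E \<longlonglongrightarrow> 0"
    unfolding E_def by simp
  define bound where "bound = norm (A *v x) + onorm ((*v) B) * sqrt (qform value_limit x / r)"
  have "qform (ric A B Q R value_limit) x \<le> qform value_limit x + E k * bound\<^sup>2" for k
  proof -
    define K where "K = lqr_gain A B R (value_iter k)"
    define D where "D = A - B ** K"
    have "qform (value_limit - value_iter k) (D *v x) \<le> E k * (norm (D *v x))\<^sup>2"
      using abs_qform_le_entry_sum[of "value_limit - value_iter k" "D *v x"] by (simp add: E_def)
    also have "\<dots> \<le> E k * bound\<^sup>2"
      using value_iter_closed_loop_bounded[of k x] unfolding bound_def D_def K_def
      by (intro mult_left_mono power_mono) (simp_all add: E_def sum_nonneg)
    moreover have "qform (ric A B Q R value_limit) x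
        \<le> qform Q x + qform R (K *v x) + qform value_limit (D *v x)"
      using ric_le_stage_cost[OF R_pos_def pos_def_imp_psd[OF pos_def_value_limit], of A B Q x "- (K *v x)"]
      by (simp add: D_def closed_loop_eq)
    moreover have "qform (value_iter (Suc k)) x
        = qform Q x + qform R (K *v x) + qform (value_iter k) (D *v x)"
      unfolding value_iter_Suc using ric_eq_lqr_cost[OF R_pos_def psd_value_iter[of k], of A B Q x]
      by (simp add: K_def D_def)
    ultimately show ?thesis
      using value_iter_le_limit[of "Suc k" x] by (simp add: qform_diff)
  qed
  moreover have "(\<lambda>k. qform value_limit x + E k * bound\<^sup>2) \<longlonglongrightarrow> qform value_limit x + 0 * bound\<^sup>2"
    by (intro tendsto_intros E_tendsto)
  ultimately show ?thesis
    by (intro LIMSEQ_le_const[of "\<lambda>k. qform value_limit x + E k * bound\<^sup>2"]) auto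
qed

lemma value_limit_fixpoint: "value_limit = ric A B Q R value_limit"
proof (rule symmetric_eq_if_qform_eq)
  show "transpose value_limit = value_limit"
    by (rule value_limit_symmetric)
  show "transpose (ric A B Q R value_limit) = ric A B Q R value_limit"
    by (rule ric_symmetric[OF Q_sym R_pos_def pos_def_imp_psd[OF pos_def_value_limit]])
  show "qform value_limit x = qform (ric A B Q R value_limit) x" for x
    using value_limit_le_ric ric_le_value_limit by (rule order_antisym)
qed

lemma dare_sol: "pos_def (dare_sol A B Q R) \<and> dare_sol A B Q R = ric A B Q R (dare_sol A B Q R)"
  unfolding dare_sol_def
proof (rule theI[of _ value_limit])
  show "pos_def value_limit \<and> value_limit = ric A B Q R value_limit"
    using pos_def_value_limit value_limit_fixpoint by simp
  show "pos_def P \<and> P = ric A B Q R P \<Longrightarrow> P = value_limit" for P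
    using dare_solution_unique[OF Q_ge q_pos R_pos_def _ _ pos_def_value_limit value_limit_fixpoint]
    by blast
qed

end

section \<open>Stability of the time-varying closed loop\<close>

lemma scaleR_mat_1_props:
  assumes "0 < c"
  shows "transpose (c *\<^sub>R mat 1 :: real^'n^'n) = c *\<^sub>R mat 1"
    and "pos_def (c *\<^sub>R mat 1 :: real^'n^'n)"
  using assms by (auto simp: transpose_scalar pos_def_iff_qform qform_scaleR_mat_1)

lemma dare_sol_scaleR_mat_1:
  fixes A :: "real^'n^'n" and B :: "real^'m^'n"
  assumes "controllable A B" "0 < q" "0 < r"
  shows "pos_def (dare_sol A B (q *\<^sub>R mat 1) (r *\<^sub>R mat 1))"
    and "dare_sol A B (q *\<^sub>R mat 1) (r *\<^sub>R mat 1)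
      = ric A B (q *\<^sub>R mat 1) (r *\<^sub>R mat 1) (dare_sol A B (q *\<^sub>R mat 1) (r *\<^sub>R mat 1))"
  using dare_sol[OF assms(1) scaleR_mat_1_props(1)[OF assms(2)] assms(2) _ scaleR_mat_1_props(2)[OF assms(3)] assms(3)]
  by (simp_all add: qform_scaleR_mat_1)

lemma Qset_iff:
  "M \<in> Qset mu l \<longleftrightarrow> transpose M = M \<and> (\<forall>x. mu * (x \<bullet> x) \<le> qform M x \<and> qform M x \<le> l * (x \<bullet> x))"
  by (auto simp: Qset_def loewner_le_iff_qform transpose_diff transpose_scalar qform_scaleR_mat_1)

lemma Pset_iff:
  fixes A :: "real^'n^'n" and B :: "real^'m^'n" and mu_f l_f mu_g l_g :: real
  defines "Pbar \<equiv> dare_sol A B (l_f *\<^sub>R mat 1) (l_g *\<^sub>R mat 1)"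
    and "Punder \<equiv> dare_sol A B (mu_f *\<^sub>R mat 1) (mu_g *\<^sub>R mat 1)"
  assumes "transpose Punder = Punder" "transpose Pbar = Pbar"
  shows "M \<in> Pset A B mu_f l_f mu_g l_g
    \<longleftrightarrow> transpose M = M \<and> (\<forall>x. qform Punder x \<le> qform M x \<and> qform M x \<le> qform Pbar x)"
  using assms(3,4) unfolding Pset_def Pbar_def[symmetric] Punder_def[symmetric]
  by (auto simp: loewner_le_iff_qform transpose_diff)

context
  fixes A :: "real^'n^'n" and B :: "real^'m^'n"
    and Q :: "nat \<Rightarrow> real^'n^'n" and R :: "nat \<Rightarrow> real^'m^'m"
    and N :: nat and mu_f mu_g l_f l_g :: real and P_lo P_hi :: "real^'n^'n"
  assumes mu_f_pos: "0 < mu_f" and mu_g_pos: "0 < mu_g" and l_g_pos: "0 < l_g"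
    and mu_f_le: "mu_f \<le> l_f"
    and Q_in: "\<forall>t<N. Q t \<in> Qset mu_f l_f"
    and R_in: "\<forall>t<N. R t \<in> Qset mu_g l_g"
    and P_lo: "pos_def P_lo" "P_lo = ric A B (mu_f *\<^sub>R mat 1) (mu_g *\<^sub>R mat 1) P_lo"
    and P_hi: "pos_def P_hi" "P_hi = ric A B (l_f *\<^sub>R mat 1) (l_g *\<^sub>R mat 1) P_hi"
    and terminal: "transpose (Q N) = Q N"
      "\<forall>x. qform P_lo x \<le> qform (Q N) x \<and> qform (Q N) x \<le> qform P_hi x"
begin

lemma P_lo_symmetric: "transpose P_lo = P_lo"
  using P_lo(1) by (simp add: pos_def_iff_qform)

lemma P_hi_symmetric: "transpose P_hi = P_hi"
  using P_hi(1) by (simp add: pos_def_iff_qform)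

lemma P_lo_ge: "mu_f * (x \<bullet> x) \<le> qform P_lo x"
  using P_lo qform_le_ric[OF scaleR_mat_1_props(2)[OF mu_g_pos] pos_def_imp_psd[OF P_lo(1)],
      of "mu_f *\<^sub>R mat 1" x A B]
  by (simp add: qform_scaleR_mat_1)

lemma P_hi_ge: "l_f * (x \<bullet> x) \<le> qform P_hi x"
  using P_hi qform_le_ric[OF scaleR_mat_1_props(2)[OF l_g_pos] pos_def_imp_psd[OF P_hi(1)],
      of "l_f *\<^sub>R mat 1" x A B]
  by (simp add: qform_scaleR_mat_1)

lemma stage_weights:
  assumes "t < N"
  shows "transpose (Q t) = Q t" "\<And>x. mu_f * (x \<bullet> x) \<le> qform (Q t) x"
    "\<And>x. qform (Q t) x \<le> l_f * (x \<bullet> x)"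
    and "pos_def (R t)" "\<And>u. mu_g * (u \<bullet> u) \<le> qform (R t) u"
    "\<And>u. qform (R t) u \<le> l_g * (u \<bullet> u)"
  using Q_in R_in assms mu_g_pos by (auto simp: Qset_iff intro: pos_def_if_qform_ge)

lemma riccati_step:
  assumes "t < N"
  shows "riccati A B Q R N t = ric A B (Q t) (R t) (riccati A B Q R N (Suc t))"
proof -
  have "N - t = Suc (N - Suc t)" "N - Suc (N - Suc t) = t"
    using assms by simp_all
  then show ?thesis by (simp add: riccati_def)
qed

text \<open>Monotonicity of \<open>ric\<close> propagates the terminal bounds backwards, since \<open>P_lo\<close> and
  \<open>P_hi\<close> are fixed points of the extreme Riccati maps.\<close>

lemma riccati_between:
  assumes "t \<le> N"
  shows "transpose (riccati A B Q R N t) = riccati A B Q R N t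
    \<and> (\<forall>x. qform P_lo x \<le> qform (riccati A B Q R N t) x \<and> qform (riccati A B Q R N t) x \<le> qform P_hi x)"
  using assms
proof (induction t rule: inc_induct)
  case base
  show ?case using terminal by (simp add: riccati_def)
next
  case (step t)
  define P where "P = riccati A B Q R N (Suc t)"
  have psd_P: "psd P"
    using step.IH P_lo_ge mu_f_pos unfolding psd_iff_qform P_def
    by (meson inner_ge_zero mult_nonneg_nonneg order.trans less_imp_le)
  have "qform P_lo x \<le> qform (ric A B (Q t) (R t) P) x" for x
    using P_lo ric_mono[OF scaleR_mat_1_props(2)[OF mu_g_pos] pos_def_imp_psd[OF P_lo(1)]
        stage_weights(4)[OF step.hyps(2)] psd_P, of "mu_f *\<^sub>R mat 1" "Q t" A B x]
      stage_weights[OF step.hyps(2)] step.IH by (simp add: qform_scaleR_mat_1 P_def)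
  moreover have "qform (ric A B (Q t) (R t) P) x \<le> qform P_hi x" for x
    using P_hi ric_mono[OF stage_weights(4)[OF step.hyps(2)] psd_P scaleR_mat_1_props(2)[OF l_g_pos]
        pos_def_imp_psd[OF P_hi(1)], of "Q t" "l_f *\<^sub>R mat 1" A B x]
      stage_weights[OF step.hyps(2)] step.IH by (simp add: qform_scaleR_mat_1 P_def)
  moreover have "transpose (ric A B (Q t) (R t) P) = ric A B (Q t) (R t) P"
    using ric_symmetric[OF stage_weights(1,4)[OF step.hyps(2)] psd_P] .
  ultimately show ?case
    using riccati_step[OF step.hyps(2)] by (simp add: P_def)
qed

lemma contraction_factor_bounds: "0 \<le> 1 - mu_f / eig_max P_hi" "1 - mu_f / eig_max P_hi < 1"
  using eig_max_ge_if_qform_ge[OF P_hi_symmetric P_hi_ge] mu_f_le mu_f_pos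
  by (simp_all add: field_simps)

lemma closed_loop_contraction:
  assumes "t < N"
  shows "qform (riccati A B Q R N (Suc t)) (closed_loop A B Q R N t *v x)
    \<le> (1 - mu_f / eig_max P_hi) * qform (riccati A B Q R N t) x"
proof -
  have "closed_loop A B Q R N t = A - B ** lqr_gain A B (R t) (riccati A B Q R N (Suc t))"
    by (simp add: closed_loop_def gain_def lqr_gain_def Let_def)
  moreover have "psd (riccati A B Q R N (Suc t))"
    using riccati_between[OF Suc_leI[OF assms]] P_lo_ge mu_f_pos unfolding psd_iff_qform
    by (meson inner_ge_zero mult_nonneg_nonneg order.trans less_imp_le)
  moreover have "qform (riccati A B Q R N t) x \<le> eig_max P_hi * (x \<bullet> x)" for x
    using riccati_between[OF less_imp_le[OF assms]] qform_le_eig_max[OF P_hi_symmetric, of x]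
    by (meson order.trans)
  moreover have "0 < eig_max P_hi"
    using eig_max_ge_if_qform_ge[OF P_hi_symmetric P_hi_ge] mu_f_le mu_f_pos by linarith
  ultimately show ?thesis
    using ric_closed_loop_contraction[OF stage_weights(4)[OF assms] _ riccati_step[OF assms]
        stage_weights(2)[OF assms] less_imp_le[OF mu_f_pos]]
    by simp
qed

lemma transition_bound:
  assumes "t0 \<le> t" "t \<le> N"
  shows "mnorm (Phi (closed_loop A B Q R N) t t0)
    \<le> sqrt (eig_max P_hi / eig_min P_lo) * sqrt (1 - mu_f / eig_max P_hi) ^ (t - t0)"
proof -
  define c where "c = 1 - mu_f / eig_max P_hi"
  have "qform (riccati A B Q R N (t0 + (t - t0))) (trans_prod (closed_loop A B Q R N) t0 (t - t0) *v x)
      \<le> c ^ (t - t0) * qform (riccati A B Q R N t0) x" for x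
    using contraction_factor_bounds(1) assms
    by (intro trans_prod_qform_decay) (simp_all add: c_def closed_loop_contraction)
  moreover have "eig_min P_lo * (y \<bullet> y) \<le> qform (riccati A B Q R N t) y" for y
    using riccati_between[OF assms(2)] eig_min_le_qform[OF P_lo_symmetric, of y]
    by (meson order.trans)
  moreover have "qform (riccati A B Q R N t0) x \<le> eig_max P_hi * (x \<bullet> x)" for x
    using riccati_between[OF order.trans[OF assms]] qform_le_eig_max[OF P_hi_symmetric, of x]
    by (meson order.trans)
  moreover have "0 < eig_min P_lo"
    using eig_min_ge_if_qform_ge[OF P_lo_symmetric P_lo_ge] mu_f_pos by linarith
  ultimately have "mnorm (trans_prod (closed_loop A B Q R N) t0 (t - t0))
      \<le> sqrt (eig_max P_hi / eig_min P_lo) * sqrt (c ^ (t - t0))"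
    using contraction_factor_bounds(1) assms(1)
    by (intro mnorm_le_if_qform_decay[where P' = "riccati A B Q R N t"]) (simp_all add: c_def)
  then show ?thesis
    by (simp add: Phi_def c_def real_sqrt_power)
qed

end

theorem lemma14:
  fixes A :: "real^'n^'n" and B :: "real^'m^'n"
    and Q :: "nat \<Rightarrow> real^'n^'n" and R :: "nat \<Rightarrow> real^'m^'m"
    and N :: nat and mu_f mu_g l_f l_g :: real
  assumes "0 < mu_f" and "0 < mu_g" and "0 < l_f" and "0 < l_g"
    and "mu_f \<le> l_f" and "mu_g \<le> l_g"
    and "controllable A B"
    and "\<forall>t<N. Q t \<in> Qset mu_f l_f"
    and "\<forall>t<N. R t \<in> Qset mu_g l_g"
    and "Q N \<in> Pset A B mu_f l_f mu_g l_g"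
  shows "(let Pbar = dare_sol A B (l_f *\<^sub>R mat 1) (l_g *\<^sub>R mat 1);
              Punder = dare_sol A B (mu_f *\<^sub>R mat 1) (mu_g *\<^sub>R mat 1);
              c7 = sqrt (eig_max Pbar / eig_min Punder);
              c2 = sqrt (1 - mu_f / eig_max Pbar)
          in 0 \<le> c2 \<and> c2 < 1 \<and>
             (\<forall>t0 t. t0 \<le> t \<and> t \<le> N \<longrightarrow>
                mnorm (Phi (closed_loop A B Q R N) t t0) \<le> c7 * c2 ^ (t - t0)))"
proof -
  define Pbar where "Pbar = dare_sol A B (l_f *\<^sub>R mat 1) (l_g *\<^sub>R mat 1)"
  define Punder where "Punder = dare_sol A B (mu_f *\<^sub>R mat 1) (mu_g *\<^sub>R mat 1)"
  note Pbar = dare_sol_scaleR_mat_1[OF assms(7,3,4), folded Pbar_def]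
  note Punder = dare_sol_scaleR_mat_1[OF assms(7,1,2), folded Punder_def]
  have "transpose Punder = Punder" "transpose Pbar = Pbar"
    using Punder(1) Pbar(1) by (simp_all add: pos_def_iff_qform)
  then have terminal: "transpose (Q N) = Q N \<and>
      (\<forall>x. qform Punder x \<le> qform (Q N) x \<and> qform (Q N) x \<le> qform Pbar x)"
    using assms(10) Pset_iff[where M = "Q N" and A = A and B = B] by (simp add: Pbar_def Punder_def)
  note context_assms = assms(1,2,4,5,8,9) Punder Pbar terminal[THEN conjunct1] terminal[THEN conjunct2]
  show ?thesis
    using contraction_factor_bounds[OF context_assms] transition_bound[OF context_assms]
    unfolding Let_def Pbar_def[symmetric] Punder_def[symmetric] by simp
qed
end
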